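(* Let $(Q,\diamond)$ be a rack and consider the corresponding braided set $(Q,r)$, where $r(x,y)=(x\diamond y,x)$ for $x,y\in Q$. A map $\mathcal{A}:Q\rightarrow Q$ is an averaging operator on the rack $Q$ if and only if $\mathcal{A}$ is an averaging operator on the braided set $(Q,r)$.
   Context: A (left) rack $(Q,\diamond)$ is a nonempty set $Q$ with a binary operation $\diamond$ such that $x\diamond(y\diamond z) = (x\diamond y)\diamond(x\diamond z)$ for all $x,y,z$, and for any $x,y$ there is a unique $c$ with $x\diamond c = y$. An averaging operator on a rack $(Q,\diamond)$ is a map $\mathcal{A}:Q\to Q$ with $\mathcal{A}(x)\diamond\mathcal{A}(y)=\mathcal{A}(\mathcal{A}(x)\diamond y)$ for all $x,y$. A braided set is a pair $(X,r)$ of a set $X$ and a map $r:X\times X\to X\times X$ satisfying $(\mathrm{Id}\times r)(r\times\mathrm{Id})(\mathrm{Id}\times r) = (r\times\mathrm{Id})(\mathrm{Id}\times r)(r\times\mathrm{Id})$; for a rack $(Q,\diamond)$, the pair $(Q,r)$ with $r(x,y)=(x\diamond y,x)$ for $x,y\in Q$ is a braided set. A (left) averaging operator on a braided set $(X,r)$ is a map $\mathcal{A}:X\to X$ satisfying $r(\mathcal{A}(x),\mathcal{A}(y)) = (\mathcal{A}\times\mathrm{Id})\,r(\mathcal{A}(x),y)$ for all $x,y\in X$. *)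

theory Defs
  imports "HOL-Library.FuncSet"
begin

locale rack =
  fixes Q :: "'a set" and dia :: "'a \<Rightarrow> 'a \<Rightarrow> 'a" (infix "\<diamond>" 70)
  assumes nonempty: "Q \<noteq> {}"
    and closed: "\<And>x y. x \<in> Q \<Longrightarrow> y \<in> Q \<Longrightarrow> x \<diamond> y \<in> Q"
    and self_distrib:
      "\<And>x y z. x \<in> Q \<Longrightarrow> y \<in> Q \<Longrightarrow> z \<in> Q \<Longrightarrow> x \<diamond> (y \<diamond> z) = (x \<diamond> y) \<diamond> (x \<diamond> z)"
    and left_division: "\<And>x y. x \<in> Q \<Longrightarrow> y \<in> Q \<Longrightarrow> \<exists>!c. c \<in> Q \<and> x \<diamond> c = y"

locale rack_averaging = rack +
  fixes A :: "'a \<Rightarrow> 'a"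
  assumes maps_to: "A \<in> Q \<rightarrow> Q"
    and averaging: "\<And>x y. x \<in> Q \<Longrightarrow> y \<in> Q \<Longrightarrow> A x \<diamond> A y = A (A x \<diamond> y)"

text \<open>The maps Id x r and r x Id on triples. Triples are right-nested pairs, so the second one
  re-associates before and after applying r to the first two components.\<close>

definition id_times :: "('a \<times> 'a \<Rightarrow> 'a \<times> 'a) \<Rightarrow> 'a \<times> 'a \<times> 'a \<Rightarrow> 'a \<times> 'a \<times> 'a" where
  "id_times r = map_prod id r"

definition times_id :: "('a \<times> 'a \<Rightarrow> 'a \<times> 'a) \<Rightarrow> 'a \<times> 'a \<times> 'a \<Rightarrow> 'a \<times> 'a \<times> 'a" where
  "times_id r = (\<lambda>((x, y), z). (x, y, z)) \<circ> map_prod r id \<circ> (\<lambda>(x, y, z). ((x, y), z))"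

locale braided_set =
  fixes X :: "'a set" and r :: "'a \<times> 'a \<Rightarrow> 'a \<times> 'a"
  assumes maps_to: "r \<in> X \<times> X \<rightarrow> X \<times> X"
    and braid: "\<And>t. t \<in> X \<times> X \<times> X \<Longrightarrow>
      (id_times r \<circ> times_id r \<circ> id_times r) t = (times_id r \<circ> id_times r \<circ> times_id r) t"

locale braided_set_averaging = braided_set +
  fixes A :: "'a \<Rightarrow> 'a"
  assumes A_maps_to: "A \<in> X \<rightarrow> X"
    and averaging: "\<And>x y. x \<in> X \<Longrightarrow> y \<in> X \<Longrightarrow> r (A x, A y) = map_prod A id (r (A x, y))"

definition rack_braiding :: "('a \<Rightarrow> 'a \<Rightarrow> 'a) \<Rightarrow> 'a \<times> 'a \<Rightarrow> 'a \<times> 'a" where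
  "rack_braiding dia = (\<lambda>(x, y). (dia x y, x))"

end

theory Submission
  imports Defs
begin

text \<open>For \<open>r = rack_braiding dia\<close>, \<open>r (A x, A y)\<close> and
  \<open>map_prod A id (r (A x, y))\<close> both have second entry \<open>A x\<close>; equality of
  their first entries is exactly the rack averaging identity.\<close>

lemma rack_braided_set:
  assumes "rack Q dia"
  shows "braided_set Q (rack_braiding dia)"
proof -
  interpret rack Q dia by fact
  show ?thesis
    \<comment> \<open>The two composites send \<open>(x, y, z)\<close> to triples ending in
      \<open>x \<diamond> y, x\<close>; their first entries agree by self-distributivity.\<close>
    by unfold_locales
      (auto simp: rack_braiding_def id_times_def times_id_def closed self_distrib[symmetric])
qed

theorem proposition5p9:
  fixes Q :: "'a set" and dia :: "'a \<Rightarrow> 'a \<Rightarrow> 'a" and A :: "'a \<Rightarrow> 'a"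
  assumes "rack Q dia" and "A \<in> Q \<rightarrow> Q"
  shows "rack_averaging Q dia A \<longleftrightarrow> braided_set_averaging Q (rack_braiding dia) A"
  \<comment> \<open>\<open>rack_braided_set\<close> supplies the \<open>braided_set\<close> half of
    the right-hand side.\<close>
  using assms rack_braided_set[OF assms(1)]
  by (auto simp: rack_averaging_def rack_averaging_axioms_def
      braided_set_averaging_def braided_set_averaging_axioms_def rack_braiding_def)

end
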